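(* Let $K$ be a field and let $k=4m$ with $m$ a positive integer. Let $$\begin{aligned} f=&\sum_{\substack{1\le i,j\le 2m\\ i\text{ odd}}}x_i\,y_j\,z_{[i+j-1]_{2m}}\,w_{[\frac{i-1}{2}+j]_{2m}} +\sum_{\substack{1\le i,j\le 2m\\ i\text{ odd}}}\overline{x}_i\,y_j\,\overline{z}_{[i+j-1]_{2m}}\,\overline{w}_{[\frac{i-1}{2}+j+m]_{2m}}\\ &+\sum_{\substack{1\le i,j\le 2m\\ i\text{ odd}}}x_i\,\overline{y}_j\,\overline{z}_{[i+j-1]_{2m}}\,\overline{w}_{[\frac{i-1}{2}+j]_{2m}} +\sum_{\substack{1\le i,j\le 2m\\ i\text{ odd}}}\overline{x}_i\,\overline{y}_j\,z_{[i+j-1]_{2m}}\,w_{[\frac{i-1}{2}+j+m]_{2m}}\\ &+\sum_{\substack{1\le i,j\le 2m\\ i\text{ even}}}x_i\,y_j\,z_{[i+j-1]_{2m}}\,\overline{w}_{[\frac{i-2}{2}+j]_{2m}} +\sum_{\substack{1\le i,j\le 2m\\ i\text{ even}}}\overline{x}_i\,y_j\,\overline{z}_{[i+j-1]_{2m}}\,w_{[\frac{i-2}{2}+j+m]_{2m}}\\ &+\sum_{\substack{1\le i,j\le 2m\\ i\text{ even}}}x_i\,\overline{y}_j\,\overline{z}_{[i+j-1]_{2m}}\,w_{[\frac{i-2}{2}+j]_{2m}} +\sum_{\substack{1\le i,j\le 2m\\ i\text{ even}}}\overline{x}_i\,\overline{y}_j\,z_{[i+j-1]_{2m}}\,\overline{w}_{[\frac{i-2}{2}+j+m]_{2m}},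 \end{aligned}$$ a polynomial in $K[x_1,\dots,x_k,y_1,\dots,y_k,z_1,\dots,z_k,w_1,\dots,w_k]$. Then $f$ is a balanced neighborly polynomial of type $(k,k,k,k)$.
   Context: For a positive integer $n$ and an integer $i$, $[i]_n\in\{1,2,\dots,n\}$ denotes the number with $[i]_n\equiv i\pmod n$. For even $k$ and $i=1,\dots,\frac{k}{2}$ put $\overline{x}_i=x_{i+\frac{k}{2}}$, $\overline{y}_i=y_{i+\frac{k}{2}}$, $\overline{z}_i=z_{i+\frac{k}{2}}$, $\overline{w}_i=w_{i+\frac{k}{2}}$. The ring $R=K[x_1,\dots,x_k,y_1,\dots,y_k,z_1,\dots,z_k,w_1,\dots,w_k]$ is $\mathbb{Z}^4$-graded by $\deg(x_i)=\mathfrak{e}_1=(1,0,0,0)$, $\deg(y_i)=\mathfrak{e}_2=(0,1,0,0)$, $\deg(z_i)=\mathfrak{e}_3=(0,0,1,0)$, $\deg(w_i)=\mathfrak{e}_4=(0,0,0,1)$. A polynomial $f\in R$ is balanced if it is homogeneous for this grading of degree $(1,1,1,1)$. For $S\subseteq\{1,2,3,4\}$ put $\mathfrak{e}_S=\sum_{i\in S}\mathfrak{e}_i$, let $R_{\mathfrak{e}_S}$ be the graded component of degree $\mathfrak{e}_S$, and for balanced $f$ set $H(f,S)=\dim_K\{g(\partial)f\mid g\in R_{\mathfrak{e}_S}\}$, where $g(\partial)$ is the differential operator obtained from $g$ by replacing each variable by the partial derivative with respect to that variable. A balanced polynomial $f\in R$ is a balanced neighborly polynomial of type $(k,k,k,k)$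 if $H(f,S)=k^{|S|}$ for every $S\subseteq\{1,2,3,4\}$ with $|S|\le 2$. *)

theory Defs
  imports "HOL-Analysis.Analysis" "HOL-Library.Poly_Mapping"
begin

text \<open>
  Polynomials over \<open>K\<close> are finitely supported maps from monomials (themselves finitely supported
  exponent vectors) to coefficients. The variable \<open>(c, i)\<close> is the \<open>i\<close>-th variable of colour
  \<open>c\<close>, where the colours 1, 2, 3, 4 stand for \<open>x, y, z, w\<close>. The numerals of the type
  \<open>4\<close> are residues modulo 4, so that the colour 4 is the element 0; 1, 2, 3, 4 are distinct and
  exhaust the type.
\<close>

type_synonym var = "4 \<times> nat"
type_synonym monom = "var \<Rightarrow>\<^sub>0 nat"
type_synonym 'a mpoly = "monom \<Rightarrow>\<^sub>0 'a"

definition mvar :: "4 \<Rightarrow> nat \<Rightarrow> 'a::field mpoly" where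
  "mvar c i = Poly_Mapping.single (Poly_Mapping.single (c, i) 1) 1"

definition poly_ring :: "nat \<Rightarrow> 'a::field mpoly set" where
  "poly_ring k = {p. \<forall>u \<in> Poly_Mapping.keys p. Poly_Mapping.keys u \<subseteq> UNIV \<times> {1..k}}"

definition mscale :: "'a::field \<Rightarrow> 'a mpoly \<Rightarrow> 'a mpoly" where
  "mscale a p = Poly_Mapping.single 0 a * p"

global_interpretation mpoly: vector_space mscale
  by unfold_locales (simp_all add: mscale_def distrib_left distrib_right single_add mult_single
      flip: mult.assoc)

definition mdeg :: "monom \<Rightarrow> int ^ 4" where
  "mdeg u = (\<Sum>v \<in> Poly_Mapping.keys u. int (Poly_Mapping.lookup u v) *s axis (fst v) 1)"

definition homogeneous :: "int ^ 4 \<Rightarrow> 'a::field mpoly \<Rightarrow> bool" where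
  "homogeneous d p \<longleftrightarrow> (\<forall>u \<in> Poly_Mapping.keys p. mdeg u = d)"

definition balanced :: "nat \<Rightarrow> 'a::field mpoly \<Rightarrow> bool" where
  "balanced k f \<longleftrightarrow> f \<in> poly_ring k \<and> homogeneous (\<chi> c. 1) f"

definition graded_component :: "nat \<Rightarrow> int ^ 4 \<Rightarrow> 'a::field mpoly set" where
  "graded_component k d = {g \<in> poly_ring k. homogeneous d g}"

definition deg_of_set :: "4 set \<Rightarrow> int ^ 4" where
  "deg_of_set S = (\<Sum>c\<in>S. axis c 1)"

text \<open>
  The subtraction of exponents truncates only if \<open>v\<close> does not occur in \<open>u\<close>, and then the
  coefficient is 0.
\<close>

definition pdiff :: "var \<Rightarrow> 'a::field mpoly \<Rightarrow> 'a mpoly" where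
  "pdiff v p = (\<Sum>u \<in> Poly_Mapping.keys p.
     Poly_Mapping.single (u - Poly_Mapping.single v 1)
       (of_nat (Poly_Mapping.lookup u v) * Poly_Mapping.lookup p u))"

lemma pdiff_superset:
  assumes "finite A" "Poly_Mapping.keys p \<subseteq> A"
  shows "pdiff v p = (\<Sum>u \<in> A.
     Poly_Mapping.single (u - Poly_Mapping.single v 1)
       (of_nat (Poly_Mapping.lookup u v) * Poly_Mapping.lookup p u))"
  unfolding pdiff_def using assms
  by (intro sum.mono_neutral_left) (auto simp: in_keys_iff)

lemma pdiff_0 [simp]: "pdiff v 0 = 0"
  by (simp add: pdiff_def)

lemma pdiff_add: "pdiff v (p + q) = pdiff v p + pdiff v q"
proof -
  let ?A = "Poly_Mapping.keys p \<union> Poly_Mapping.keys q"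
  have "Poly_Mapping.keys (p + q) \<subseteq> ?A" by (rule Poly_Mapping.keys_add)
  then show ?thesis
    by (simp add: pdiff_superset[of ?A] lookup_add distrib_left single_add sum.distrib)
qed

lemma pdiff_sum: "pdiff v (\<Sum>a\<in>A. f a) = (\<Sum>a\<in>A. pdiff v (f a))"
  by (induction A rule: infinite_finite_induct) (simp_all add: pdiff_add)

lemma pdiff_single:
  "pdiff v (Poly_Mapping.single u a) =
     Poly_Mapping.single (u - Poly_Mapping.single v 1) (of_nat (Poly_Mapping.lookup u v) * a)"
  by (subst pdiff_superset[of "{u}"]) auto

lemma sum_single_keys:
  "(\<Sum>u\<in>Poly_Mapping.keys p. Poly_Mapping.single u (Poly_Mapping.lookup p u)) = p"
proof (rule poly_mapping_eqI)
  fix u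
  show "Poly_Mapping.lookup
      (\<Sum>u\<in>Poly_Mapping.keys p. Poly_Mapping.single u (Poly_Mapping.lookup p u)) u
    = Poly_Mapping.lookup p u"
    by (cases "u \<in> Poly_Mapping.keys p")
      (simp_all add: lookup_sum lookup_single when_def in_keys_iff)
qed

lemma pdiff_commute: "pdiff v (pdiff w p) = pdiff w (pdiff v p)"
proof -
  have "pdiff v (pdiff w (Poly_Mapping.single u a)) = pdiff w (pdiff v (Poly_Mapping.single u a))"
    for u and a :: 'a
    by (cases "v = w")
      (auto simp: pdiff_single lookup_minus lookup_single when_def diff_diff_eq ac_simps)
  then have "pdiff v (pdiff w q) = pdiff w (pdiff v q)"
    if "q = (\<Sum>u\<in>Poly_Mapping.keys p. Poly_Mapping.single u (Poly_Mapping.lookup p u))" for q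
    by (simp add: that pdiff_sum)
  then show ?thesis
    by (simp add: sum_single_keys)
qed

text \<open>
  Partial derivatives commute, so the order in which the fold visits the variables is irrelevant.
\<close>

definition monom_diff :: "monom \<Rightarrow> 'a::field mpoly \<Rightarrow> 'a mpoly" where
  "monom_diff u f =
     Finite_Set.fold (\<lambda>v. pdiff v ^^ Poly_Mapping.lookup u v) f (Poly_Mapping.keys u)"

lemma comp_fun_commute_pdiff_power:
  "comp_fun_commute (\<lambda>v. pdiff v ^^ e v :: 'a::field mpoly \<Rightarrow> 'a mpoly)"
proof
  fix v w :: var
  have *: "pdiff w ((pdiff v ^^ n) p) = (pdiff v ^^ n) (pdiff w p)" for n and p :: "'a mpoly"
    by (induction n) (simp_all add: pdiff_commute)
  have **: "(pdiff w ^^ l) ((pdiff v ^^ n) p) = (pdiff v ^^ n) ((pdiff w ^^ l) p)"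
    for l n and p :: "'a mpoly"
    by (induction l) (simp_all add: *)
  show "(pdiff w ^^ e w) \<circ> (pdiff v ^^ e v) = (pdiff v ^^ e v) \<circ> (pdiff w ^^ e w :: 'a mpoly \<Rightarrow> _)"
    unfolding o_def by (rule ext) (rule **)
qed

definition diff_op :: "'a::field mpoly \<Rightarrow> 'a mpoly \<Rightarrow> 'a mpoly" where
  "diff_op g f = (\<Sum>u \<in> Poly_Mapping.keys g. mscale (Poly_Mapping.lookup g u) (monom_diff u f))"

text \<open>
  The set below is a finite-dimensional subspace, since only finitely many monomials in the
  variables with indices in \<open>{1..k}\<close> have a given degree; so the convention of \<open>dim\<close> for
  infinite-dimensional spaces plays no role.
\<close>

definition H :: "nat \<Rightarrow> 'a::field mpoly \<Rightarrow> 4 set \<Rightarrow> nat" where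
  "H k f S = mpoly.dim {diff_op g f |g. g \<in> graded_component k (deg_of_set S)}"

definition balanced_neighborly :: "nat \<Rightarrow> 'a::field mpoly \<Rightarrow> bool" where
  "balanced_neighborly k f \<longleftrightarrow>
     balanced k f \<and> (\<forall>S \<subseteq> {1, 2, 3, 4}. card S \<le> 2 \<longrightarrow> H k f S = k ^ card S)"

text \<open>\<open>wrap n i\<close> is \<open>[i]\<^sub>n\<close>, the representative of \<open>i\<close> modulo \<open>n\<close> in \<open>{1..n}\<close>.\<close>

definition wrap :: "nat \<Rightarrow> int \<Rightarrow> nat" where
  "wrap n i = nat ((i - 1) mod int n) + 1"

lemma wrap_bounds: "n > 0 \<Longrightarrow> wrap n i \<in> {1..n}"
  by (simp add: wrap_def nat_less_iff Suc_le_eq)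

lemma wrap_mod: "n > 0 \<Longrightarrow> int (wrap n i) mod int n = i mod int n"
  by (simp add: wrap_def mod_simps)

definition X :: "nat \<Rightarrow> 'a::field mpoly" where "X i = mvar 1 i"
definition Y :: "nat \<Rightarrow> 'a::field mpoly" where "Y i = mvar 2 i"
definition Z :: "nat \<Rightarrow> 'a::field mpoly" where "Z i = mvar 3 i"
definition W :: "nat \<Rightarrow> 'a::field mpoly" where "W i = mvar 4 i"

text \<open>\<open>Xb k i\<close> is \<open>x\<^sub>i\<close> with a bar, relative to \<open>k\<close>; similarly for the other letters.\<close>

definition Xb :: "nat \<Rightarrow> nat \<Rightarrow> 'a::field mpoly" where "Xb k i = X (i + k div 2)"
definition Yb :: "nat \<Rightarrow> nat \<Rightarrow> 'a::field mpoly" where "Yb k i = Y (i + k div 2)"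
definition Zb :: "nat \<Rightarrow> nat \<Rightarrow> 'a::field mpoly" where "Zb k i = Z (i + k div 2)"
definition Wb :: "nat \<Rightarrow> nat \<Rightarrow> 'a::field mpoly" where "Wb k i = W (i + k div 2)"

end

theory Submission
  imports Defs "HOL-Number_Theory.Cong"
begin

text \<open>
  The \<open>k\<^sup>2\<close> monomials of the polynomial, read as words \<open>\<phi>\<close> of length 4 over \<open>{1..k}\<close>, form an
  orthogonal array of strength 2: any two letters of a word determine it, and can be prescribed
  arbitrarily. Let \<open>card S \<le> 2\<close>. Differentiating along the variables \<open>(c, \<psi> c)\<close> with \<open>c \<in> S\<close> keeps
  exactly the words extending \<open>\<psi>\<close>, of which there is at least one, with the letters at \<open>S\<close> erased.
  Since the complement of \<open>S\<close> has at least two elements, the remaining letters still determine the word. So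
  the \<open>k ^ card S\<close> derivatives are nonzero with pairwise disjoint supports, hence linearly independent.
\<close>

subsection \<open>Multilinear monomials\<close>

text \<open>The set \<open>S\<close> records which letters have not been erased. Differentiation
  only shrinks \<open>S\<close> and never changes the word, so this one family covers both the
  monomials of the polynomial and those of all derivatives considered.\<close>

definition word_monom :: "4 set \<Rightarrow> (4 \<Rightarrow> nat) \<Rightarrow> monom" where
  "word_monom S \<phi> = (\<Sum>c\<in>S. Poly_Mapping.single (c, \<phi> c) 1)"

lemma lookup_word_monom:
  "Poly_Mapping.lookup (word_monom S \<phi>) (c, i) = (if c \<in> S \<and> \<phi> c = i then 1 else 0)"
proof -
  have "Poly_Mapping.lookup (word_monom S \<phi>) (c, i)
      = (\<Sum>d\<in>S. if d = c then (if \<phi> c = i then 1 else 0) else 0)"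
    unfolding word_monom_def lookup_sum lookup_single
    by (rule sum.cong) (auto simp: when_def)
  then show ?thesis by simp
qed

lemma keys_word_monom: "Poly_Mapping.keys (word_monom S \<phi>) = (\<lambda>c. (c, \<phi> c)) ` S"
  by (auto simp: in_keys_iff lookup_word_monom split: if_splits)

lemma word_monom_eq_iff: "word_monom S \<phi> = word_monom S \<psi> \<longleftrightarrow> (\<forall>c\<in>S. \<phi> c = \<psi> c)"
proof
  assume "word_monom S \<phi> = word_monom S \<psi>"
  then have "Poly_Mapping.lookup (word_monom S \<phi>) (c, \<phi> c)
      = Poly_Mapping.lookup (word_monom S \<psi>) (c, \<phi> c)" for c
    by simp
  then show "\<forall>c\<in>S. \<phi> c = \<psi> c"
    by (simp add: lookup_word_monom) (metis zero_neq_one)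
qed (simp add: word_monom_def)

lemma mdeg_nth:
  "mdeg u $ c = int (\<Sum>v\<in>{v \<in> Poly_Mapping.keys u. fst v = c}. Poly_Mapping.lookup u v)"
proof -
  have "mdeg u $ c
      = (\<Sum>v\<in>Poly_Mapping.keys u. if fst v = c then int (Poly_Mapping.lookup u v) else 0)"
    unfolding mdeg_def sum_component
    by (rule sum.cong) (auto simp: axis_def)
  then show ?thesis
    by (simp only: of_nat_sum) (rule sum.inter_filter[symmetric], simp)
qed

lemma deg_of_set_nth: "deg_of_set S $ c = (if c \<in> S then 1 else 0)"
  by (simp add: deg_of_set_def axis_def)

lemma mdeg_word_monom: "mdeg (word_monom S \<phi>) = deg_of_set S"
proof (rule vec_eq_iff[THEN iffD2], rule allI)
  fix c
  have "{v \<in> Poly_Mapping.keys (word_monom S \<phi>). fst v = c} = (if c \<in> S then {(c, \<phi> c)} else {})"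
    by (auto simp: keys_word_monom)
  then show "mdeg (word_monom S \<phi>) $ c = deg_of_set S $ c"
    by (simp add: mdeg_nth deg_of_set_nth lookup_word_monom)
qed

text \<open>For each colour the exponents add up to 1 or 0, and natural numbers with sum 1 are a
  single 1 and zeros otherwise. So the operators of degree \<open>deg_of_set S\<close> are
  combinations of word monomials.\<close>

lemma word_monom_of_mdeg:
  assumes u: "Poly_Mapping.keys u \<subseteq> UNIV \<times> {1..k}" and deg: "mdeg u = deg_of_set S"
  shows "u \<in> word_monom S ` (S \<rightarrow>\<^sub>E {1..k})"
proof -
  let ?F = "\<lambda>c. {v \<in> Poly_Mapping.keys u. fst v = c}"
  have sum: "(\<Sum>v\<in>?F c. Poly_Mapping.lookup u v) = (if c \<in> S then 1 else 0)" for c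
    using arg_cong[OF deg, of "\<lambda>d. d $ c"] unfolding mdeg_nth deg_of_set_nth
    by (simp split: if_splits del: of_nat_sum)
  have fin: "finite (?F c)" for c by simp
  let ?Q = "\<lambda>c i. (c, i) \<in> ?F c \<and> Poly_Mapping.lookup u (c, i) = 1
      \<and> (\<forall>j. j \<noteq> i \<longrightarrow> Poly_Mapping.lookup u (c, j) = 0)"
  have "\<exists>i. ?Q c i" if c: "c \<in> S" for c
  proof -
    from sum[of c] c have "(\<Sum>v\<in>?F c. Poly_Mapping.lookup u v) = 1" by simp
    then obtain v where v: "v \<in> ?F c" "Poly_Mapping.lookup u v = 1"
        "\<And>w. w \<in> ?F c \<Longrightarrow> v \<noteq> w \<Longrightarrow> Poly_Mapping.lookup u w = 0"
      unfolding sum_eq_1_iff[OF fin] by blast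
    obtain i where i: "v = (c, i)" using v(1) by (cases v) auto
    have zero: "Poly_Mapping.lookup u (c, j) = 0" if "j \<noteq> i" for j
      using v(3)[of "(c, j)"] that i by (cases "(c, j) \<in> Poly_Mapping.keys u") (auto simp: in_keys_iff)
    show ?thesis
      by (intro exI[of _ i]) (use v(1,2) i zero in simp)
  qed
  then have "\<forall>c\<in>S. \<exists>i. ?Q c i" by blast
  from bchoice[OF this] obtain \<psi> where "\<forall>c\<in>S. ?Q c (\<psi> c)" ..
  then have \<psi>: "\<And>c. c \<in> S \<Longrightarrow> (c, \<psi> c) \<in> ?F c"
      "\<And>c. c \<in> S \<Longrightarrow> Poly_Mapping.lookup u (c, \<psi> c) = 1"
      "\<And>c j. c \<in> S \<Longrightarrow> j \<noteq> \<psi> c \<Longrightarrow> Poly_Mapping.lookup u (c, j) = 0"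
    by blast+
  have out: "Poly_Mapping.lookup u (c, i) = 0" if "c \<notin> S" for c i
    using sum[of c] that by (cases "(c, i) \<in> Poly_Mapping.keys u") (auto simp: in_keys_iff)
  have "u = word_monom S (restrict \<psi> S)"
  proof (rule poly_mapping_eqI)
    fix v :: var
    obtain c i where "v = (c, i)" by (cases v)
    then show "Poly_Mapping.lookup u v = Poly_Mapping.lookup (word_monom S (restrict \<psi> S)) v"
      using \<psi> out by (auto simp: lookup_word_monom)
  qed
  moreover have "restrict \<psi> S \<in> S \<rightarrow>\<^sub>E {1..k}"
    using \<psi>(1) u by fastforce
  ultimately show ?thesis by blast
qed

subsection \<open>Derivatives\<close>

text \<open>All exponents of a word monomial are 1, so the fold of powers is a fold of plain
  \<open>pdiff\<close> over the keys, and \<open>c \<notin> S\<close> makes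
  \<open>(c, \<psi> c)\<close> a new key.\<close>

lemma monom_diff_word_monom_insert:
  assumes "c \<notin> S"
  shows "monom_diff (word_monom (insert c S) \<psi>) f
    = pdiff (c, \<psi> c) (monom_diff (word_monom S \<psi>) f)"
proof -
  have fold: "monom_diff (word_monom T \<psi>) f = Finite_Set.fold pdiff f ((\<lambda>c. (c, \<psi> c)) ` T)" for T
    unfolding monom_diff_def keys_word_monom
  proof (rule Finite_Set.fold_cong)
    show "comp_fun_commute_on UNIV (\<lambda>v. pdiff v ^^ Poly_Mapping.lookup (word_monom T \<psi>) v)"
      using comp_fun_commute_pdiff_power by (simp add: comp_fun_commute_def')
    show "comp_fun_commute_on UNIV (pdiff :: _ \<Rightarrow> 'a mpoly \<Rightarrow> _)"
      using comp_fun_commute_pdiff_power[of "\<lambda>_. 1"] by (simp add: comp_fun_commute_def')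
  qed (auto simp: lookup_word_monom)
  interpret comp_fun_commute "pdiff :: _ \<Rightarrow> 'a mpoly \<Rightarrow> _"
    using comp_fun_commute_pdiff_power[of "\<lambda>_. 1"] by simp
  show ?thesis
    unfolding fold image_insert by (rule fold_insert) (use assms in auto)
qed

text \<open>Since exponents are 0 or 1, the factor produced by the derivative is 0 or 1 as well.
  This is why the characteristic of the field has no influence.\<close>

lemma pdiff_single_word_monom:
  "pdiff (c, i) (Poly_Mapping.single (word_monom T \<phi>) a)
    = (if c \<in> T \<and> \<phi> c = i then Poly_Mapping.single (word_monom (T - {c}) \<phi>) a else 0)"
proof -
  have "word_monom T \<phi> - Poly_Mapping.single (c, i) 1 = word_monom (T - {c}) \<phi>"
    if "c \<in> T" "\<phi> c = i"
  proof (rule poly_mapping_eqI)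
    fix v :: var
    obtain d j where "v = (d, j)" by (cases v)
    then show "Poly_Mapping.lookup (word_monom T \<phi> - Poly_Mapping.single (c, i) 1) v
        = Poly_Mapping.lookup (word_monom (T - {c}) \<phi>) v"
      using that by (auto simp: lookup_minus lookup_word_monom lookup_single when_def)
  qed
  then show ?thesis
    by (auto simp: pdiff_single lookup_word_monom)
qed

lemma monom_diff_word_monom_sum:
  "monom_diff (word_monom S \<psi>) (\<Sum>\<phi>\<in>C. Poly_Mapping.single (word_monom UNIV \<phi>) (1::'a::field))
    = (\<Sum>\<phi>\<in>C. if \<forall>c\<in>S. \<phi> c = \<psi> c then Poly_Mapping.single (word_monom (- S) \<phi>) 1 else 0)"
    (is "_ = (\<Sum>\<phi>\<in>C. ?t S \<phi>)")
proof -
  have "finite S" by simp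
  then show ?thesis
  proof induction
    case empty
    show ?case by (simp add: monom_diff_def word_monom_def flip: Compl_eq_Diff_UNIV)
  next
    case (insert c S)
    have "pdiff (c, \<psi> c) (?t S \<phi>) = ?t (insert c S) \<phi>" for \<phi>
      using insert.hyps
      by (auto simp: pdiff_single_word_monom set_diff_eq
          intro!: arg_cong2[where f = Poly_Mapping.single] arg_cong2[where f = word_monom])
    then show ?case
      by (simp add: monom_diff_word_monom_insert insert pdiff_sum)
  qed
qed

section \<open>Spaces of derivatives and their dimension\<close>

lemma diff_op_superset:
  assumes "finite A" "Poly_Mapping.keys g \<subseteq> A"
  shows "diff_op g f = (\<Sum>u\<in>A. mscale (Poly_Mapping.lookup g u) (monom_diff u f))"
  unfolding diff_op_def using assms
  by (intro sum.mono_neutral_left) (auto simp: in_keys_iff)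

lemma finite_PiE_UNIV4: "finite ((S::4 set) \<rightarrow>\<^sub>E {1..k::nat})"
  by (intro finite_PiE) auto

text \<open>An operator of this degree is an arbitrary combination of the finitely many word
  monomials on \<open>S\<close>, and \<open>diff_op\<close> is linear in the operator.\<close>

lemma diff_op_image_eq_span:
  "{diff_op g f |g. g \<in> graded_component k (deg_of_set S)}
    = mpoly.span ((\<lambda>\<psi>. monom_diff (word_monom S \<psi>) f) ` (S \<rightarrow>\<^sub>E {1..k}))"
proof -
  let ?P = "S \<rightarrow>\<^sub>E {1..k}" and ?D = "\<lambda>\<psi>. monom_diff (word_monom S \<psi>) f"
  let ?U = "word_monom S ` ?P" and ?M = "\<lambda>u. monom_diff u f"
  have fin: "finite ?U" using finite_PiE_UNIV4 by blast
  have im: "?D ` ?P = ?M ` ?U" by (simp add: image_image)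
  have keys: "Poly_Mapping.keys g \<subseteq> ?U" if "g \<in> graded_component k (deg_of_set S)" for g :: "'a mpoly"
    using that word_monom_of_mdeg
    unfolding graded_component_def poly_ring_def homogeneous_def by blast
  show ?thesis unfolding im
  proof (intro equalityI subsetI)
    fix p assume "p \<in> {diff_op g f |g. g \<in> graded_component k (deg_of_set S)}"
    then obtain g where "p = diff_op g f" and g: "g \<in> graded_component k (deg_of_set S)" by blast
    then have "p = (\<Sum>u\<in>?U. mscale (Poly_Mapping.lookup g u) (?M u))"
      using diff_op_superset[OF fin keys[OF g]] by simp
    then show "p \<in> mpoly.span (?M ` ?U)"
      by (simp only:) (intro mpoly.span_sum mpoly.span_scale mpoly.span_base imageI)
  next
    fix p assume "p \<in> mpoly.span (?M ` ?U)"
    then obtain r where r: "p = (\<Sum>q\<in>?M ` ?U. mscale (r q) q)"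
      using fin by (auto simp: mpoly.span_finite)
    \<comment> \<open>For a general \<open>f\<close> different monomials may yield the same
      derivative. \<open>U\<close> keeps one monomial per derivative, so that the coefficients of
      \<open>p\<close> can be carried over to an operator without counting any of them
      twice.\<close>
    obtain U where U: "U \<subseteq> ?U" "inj_on ?M U" "?M ` ?U = ?M ` U"
      using subset_image_inj[of "?M ` ?U" ?M ?U] by blast
    have finU: "finite U" using U(1) fin finite_subset by blast
    define g where "g = (\<Sum>u\<in>U. Poly_Mapping.single u (r (?M u)))"
    have look: "Poly_Mapping.lookup g u = (if u \<in> U then r (?M u) else 0)" for u
      using finU by (simp add: g_def lookup_sum lookup_single when_def)
    then have sub: "Poly_Mapping.keys g \<subseteq> U"
      by (auto simp: in_keys_iff split: if_splits)
    have "p = (\<Sum>u\<in>U. mscale (r (?M u)) (?M u))"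
      unfolding r U(3) using U(2) by (simp add: sum.reindex)
    also have "\<dots> = diff_op g f"
      unfolding diff_op_superset[OF finU sub] by (simp add: look)
    finally have "p = diff_op g f" .
    moreover have "g \<in> graded_component k (deg_of_set S)"
      using sub U(1) unfolding graded_component_def poly_ring_def homogeneous_def
      by (fastforce simp: keys_word_monom mdeg_word_monom)
    ultimately show "p \<in> {diff_op g f |g. g \<in> graded_component k (deg_of_set S)}" by blast
  qed
qed

lemma lookup_mscale: "Poly_Mapping.lookup (mscale a p) u = a * Poly_Mapping.lookup p u"
  by (simp add: mscale_def map.rep_eq when_def flip: mult_map_scale_conv_mult)

text \<open>The coefficients at the monomials \<open>e i\<close> are functionals dual to the family:
  reading a vanishing combination at \<open>e i\<close> isolates the coefficient of
  \<open>D i\<close>.\<close>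

lemma dim_span_dual_family:
  fixes D :: "'b \<Rightarrow> 'a::field mpoly"
  assumes fin: "finite I"
    and dual: "\<And>i j. i \<in> I \<Longrightarrow> j \<in> I \<Longrightarrow> Poly_Mapping.lookup (D j) (e i) = (if j = i then 1 else 0)"
  shows "mpoly.dim (mpoly.span (D ` I)) = card I"
proof -
  have inj: "inj_on D I"
    by (rule inj_onI) (metis dual zero_neq_one)
  have "\<not> mpoly.dependent (D ` I)"
  proof
    assume "mpoly.dependent (D ` I)"
    then obtain r i where i: "i \<in> I" "r (D i) \<noteq> 0" and "(\<Sum>p\<in>D ` I. mscale (r p) p) = 0"
      using fin by (auto simp: mpoly.dependent_finite)
    then have "(\<Sum>j\<in>I. mscale (r (D j)) (D j)) = 0"
      using inj by (simp add: sum.reindex)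
    then have "Poly_Mapping.lookup (\<Sum>j\<in>I. mscale (r (D j)) (D j)) (e i) = 0"
      by simp
    then have "(\<Sum>j\<in>I. r (D j) * Poly_Mapping.lookup (D j) (e i)) = 0"
      by (simp only: lookup_sum lookup_mscale)
    also have "(\<Sum>j\<in>I. r (D j) * Poly_Mapping.lookup (D j) (e i))
        = (\<Sum>j\<in>I. if j = i then r (D i) else 0)"
      by (rule sum.cong) (auto simp: dual i)
    finally show False using i fin by simp
  qed
  then show ?thesis
    by (simp add: mpoly.dim_eq_card_independent card_image inj)
qed

subsection \<open>Orthogonal arrays\<close>

locale orthogonal_array =
  fixes k :: nat and C :: "(4 \<Rightarrow> nat) set"
  assumes pos: "k > 0"
    and range: "\<phi> \<in> C \<Longrightarrow> \<phi> c \<in> {1..k}"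
    and card: "card C = k\<^sup>2"
    and inj_pair: "c \<noteq> d \<Longrightarrow> inj_on (\<lambda>\<phi>. (\<phi> c, \<phi> d)) C"
begin

definition poly :: "'a::field mpoly" where
  "poly = (\<Sum>\<phi>\<in>C. Poly_Mapping.single (word_monom UNIV \<phi>) 1)"

lemma finite_C: "finite C"
proof (rule finite_subset)
  show "C \<subseteq> UNIV \<rightarrow>\<^sub>E {1..k}" using range by auto
qed (rule finite_PiE_UNIV4)

text \<open>By counting: the \<open>k\<^sup>2\<close> words inject into the \<open>k\<^sup>2\<close>
  pairs of letters, so every pair occurs. Hence the locale needs only injectivity and the
  cardinality as assumptions.\<close>

lemma pair_surj:
  assumes "c \<noteq> d" "i \<in> {1..k}" "j \<in> {1..k}"
  obtains \<phi> where "\<phi> \<in> C" "\<phi> c = i" "\<phi> d = j"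
proof -
  have "(\<lambda>\<phi>. (\<phi> c, \<phi> d)) ` C = {1..k} \<times> {1..k}"
  proof (rule card_subset_eq)
    show "card ((\<lambda>\<phi>. (\<phi> c, \<phi> d)) ` C) = card ({1..k} \<times> {1..k})"
      by (simp add: card_image[OF inj_pair[OF assms(1)]] card power2_eq_square)
  qed (use range in auto)
  then have "(i, j) \<in> (\<lambda>\<phi>. (\<phi> c, \<phi> d)) ` C" using assms by simp
  then show thesis using that by auto
qed

text \<open>Padding to two colours lets the sizes 0, 1 and 2 of \<open>S\<close> be treated
  alike.\<close>

lemma subset_pair:
  fixes S :: "4 set"
  assumes "card S \<le> 2"
  obtains c d where "c \<noteq> d" "S \<subseteq> {c, d}"
proof -
  obtain T where T: "S \<subseteq> T" "card T = 2"
    using exists_subset_between[of S 2 UNIV] assms by auto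
  then show thesis using that by (auto simp: card_2_iff)
qed

lemma word_extends:
  assumes "card S \<le> 2" "\<psi> \<in> S \<rightarrow>\<^sub>E {1..k}"
  obtains \<phi> where "\<phi> \<in> C" "\<forall>c\<in>S. \<phi> c = \<psi> c"
proof -
  obtain c d where cd: "c \<noteq> d" "S \<subseteq> {c, d}" using subset_pair[OF assms(1)] .
  \<comment> \<open>At the padding colours any letter would do; 1 is a legal one because of
    \<open>pos\<close>.\<close>
  let ?v = "\<lambda>b. if b \<in> S then \<psi> b else 1"
  have "?v b \<in> {1..k}" for b using assms(2) pos by auto
  then obtain \<phi> where "\<phi> \<in> C" "\<phi> c = ?v c" "\<phi> d = ?v d"
    using pair_surj[OF cd(1)] by metis
  then show thesis using that cd(2) by fastforce
qed

lemma word_determined: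
  assumes S: "card S \<le> 2" and \<phi>: "\<phi> \<in> C" "\<phi>' \<in> C" and eq: "\<forall>c\<in>- S. \<phi> c = \<phi>' c"
  shows "\<phi> = \<phi>'"
proof -
  have "2 \<le> card (- S)" using S by (simp add: Compl_eq_Diff_UNIV card_Diff_subset)
  then obtain T where T: "T \<subseteq> - S" "card T = 2" using obtain_subset_with_card_n by metis
  then obtain c d where "c \<noteq> d" "c \<in> - S" "d \<in> - S" by (auto simp: card_2_iff)
  then show ?thesis using inj_onD[OF inj_pair] \<phi> eq by blast
qed

lemma H_poly:
  assumes S: "card S \<le> 2"
  shows "H k (poly :: 'a::field mpoly) S = k ^ card S"
proof -
  let ?P = "S \<rightarrow>\<^sub>E {1..k}"
  let ?D = "\<lambda>\<psi>. monom_diff (word_monom S \<psi>) (poly :: 'a mpoly)"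
  \<comment> \<open>If \<open>S\<close> has fewer than two elements, a word on \<open>S\<close> can
    have several extensions. Any one of them provides a monomial that singles out the derivative
    along \<psi>.\<close>
  define ext where "ext \<psi> = (SOME \<phi>. \<phi> \<in> C \<and> (\<forall>c\<in>S. \<phi> c = \<psi> c))" for \<psi>
  have ext: "ext \<psi> \<in> C \<and> (\<forall>c\<in>S. ext \<psi> c = \<psi> c)" if \<psi>: "\<psi> \<in> ?P" for \<psi>
  proof -
    obtain \<phi> where "\<phi> \<in> C" "\<forall>c\<in>S. \<phi> c = \<psi> c" using word_extends[OF S \<psi>] .
    then have "\<phi> \<in> C \<and> (\<forall>c\<in>S. \<phi> c = \<psi> c)" by blast
    then show ?thesis
      unfolding ext_def by (rule someI[of "\<lambda>\<phi>. \<phi> \<in> C \<and> (\<forall>c\<in>S. \<phi> c = \<psi> c)"])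
  qed
  have dual: "Poly_Mapping.lookup (?D \<rho>) (word_monom (- S) (ext \<psi>)) = (if \<rho> = \<psi> then 1 else 0)"
    if \<psi>: "\<psi> \<in> ?P" and \<rho>: "\<rho> \<in> ?P" for \<psi> \<rho>
  proof -
    \<comment> \<open>Erasing the letters at \<open>S\<close> merges no two words of
      \<open>C\<close>, so only the term of \<open>ext \<psi>\<close> can contribute to the
      coefficient.\<close>
    have "word_monom (- S) \<phi> = word_monom (- S) (ext \<psi>) \<longleftrightarrow> \<phi> = ext \<psi>" if "\<phi> \<in> C" for \<phi>
      using word_determined[OF S that] ext[OF \<psi>] unfolding word_monom_eq_iff by metis
    then have "Poly_Mapping.lookup (?D \<rho>) (word_monom (- S) (ext \<psi>))
        = (\<Sum>\<phi>\<in>C. if \<phi> = ext \<psi> then (if \<forall>c\<in>S. ext \<psi> c = \<rho> c then 1 else 0) else 0)"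
      unfolding poly_def monom_diff_word_monom_sum lookup_sum
      by (intro sum.cong) (auto simp: lookup_single when_def)
    \<comment> \<open>Both \<rho> and \<psi> are extensional on \<open>S\<close>, so agreement on
      \<open>S\<close> is equality.\<close>
    moreover have "(\<forall>c\<in>S. ext \<psi> c = \<rho> c) \<longleftrightarrow> \<rho> = \<psi>"
      using ext[OF \<psi>] \<psi> \<rho> PiE_ext by metis
    ultimately show ?thesis
      using ext[OF \<psi>] by (simp add: finite_C)
  qed
  have "H k (poly :: 'a mpoly) S = mpoly.dim (mpoly.span (?D ` ?P))"
    by (simp add: H_def diff_op_image_eq_span)
  also have "\<dots> = card ?P"
    by (rule dim_span_dual_family[OF finite_PiE_UNIV4 dual])
  also have "\<dots> = k ^ card S" by (simp add: card_PiE)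
  finally show ?thesis .
qed

lemma balanced_poly: "balanced k (poly :: 'a::field mpoly)"
proof -
  have "Poly_Mapping.lookup (poly :: 'a mpoly) u = 0" if "u \<notin> word_monom UNIV ` C" for u
    unfolding poly_def lookup_sum
    using that by (intro sum.neutral) (auto simp: lookup_single when_def)
  then have keys: "Poly_Mapping.keys (poly :: 'a mpoly) \<subseteq> word_monom UNIV ` C"
    by (auto simp: in_keys_iff)
  have "(\<chi> c. 1) = deg_of_set UNIV"
    by (simp add: vec_eq_iff deg_of_set_nth)
  then have "homogeneous (\<chi> c. 1) (poly :: 'a mpoly)"
    using keys unfolding homogeneous_def by (auto simp: mdeg_word_monom)
  moreover have "(poly :: 'a mpoly) \<in> poly_ring k"
    using keys range unfolding poly_ring_def by (force simp: keys_word_monom)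
  ultimately show ?thesis by (simp add: balanced_def)
qed

lemma balanced_neighborly_poly: "balanced_neighborly k poly"
  by (simp add: balanced_neighborly_def balanced_poly H_poly)

end

subsection \<open>The words of the polynomial\<close>

definition bar :: "nat \<Rightarrow> bool \<Rightarrow> nat \<Rightarrow> nat" where
  "bar n b i = (if b then i + n else i)"

text \<open>Barred and plain indices fill the disjoint halves \<open>{n+1..2*n}\<close> and
  \<open>{1..n}\<close>. With this, equality of letters splits into equality of flags and a
  statement about indices.\<close>

lemma bar_eq_iff:
  "i \<in> {1..n} \<Longrightarrow> j \<in> {1..n} \<Longrightarrow> bar n b i = bar n c j \<longleftrightarrow> b = c \<and> i = j"
  by (auto simp: bar_def)

lemma wrap_eq_iff: "n > 0 \<Longrightarrow> wrap n a = wrap n b \<longleftrightarrow> [a = b] (mod int n)"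
  by (simp add: wrap_def cong_diff_iff_cong_0 eq_nat_nat_iff flip: cong_def)
     (simp add: cong_iff_dvd_diff)

lemma bar_wrap_eq_iff:
  assumes "n > 0"
  shows "bar n b (wrap n x) = bar n c (wrap n y) \<longleftrightarrow> b = c \<and> [x = y] (mod int n)"
  by (simp only: bar_eq_iff[OF wrap_bounds[OF assms] wrap_bounds[OF assms]] wrap_eq_iff[OF assms])

text \<open>
  The word of the term in which \<open>x\<^sub>i\<close> is barred if \<open>s\<close> and \<open>y\<^sub>j\<close> is barred if \<open>t\<close>. Integer
  division makes \<open>(i - 1) div 2\<close> cover both \<open>(i - 1) / 2\<close> for odd and \<open>(i - 2) / 2\<close> for even \<open>i\<close>.
\<close>

definition word :: "nat \<Rightarrow> bool \<times> bool \<times> nat \<times> nat \<Rightarrow> 4 \<Rightarrow> nat" where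
  "word m = (\<lambda>(s, t, i, j) c.
     if c = 1 then bar (2*m) s i
     else if c = 2 then bar (2*m) t j
     else if c = 3 then bar (2*m) (s \<noteq> t) (wrap (2*m) (int i + int j - 1))
     else bar (2*m) ((s \<noteq> t) \<noteq> even i)
       (wrap (2*m) ((int i - 1) div 2 + int j + (if s then int m else 0))))"

text \<open>The two flags and the parity of \<open>i\<close> select one of the eight sums. The
  number of parameters is \<open>2 * 2 * (2*m) * (2*m)\<close>, which is the square of
  \<open>4*m\<close>.\<close>

definition params :: "nat \<Rightarrow> (bool \<times> bool \<times> nat \<times> nat) set" where
  "params m = UNIV \<times> UNIV \<times> {1..2*m} \<times> {1..2*m}"

lemma word_nth:
  "word m (s, t, i, j) 1 = bar (2*m) s i"
  "word m (s, t, i, j) 2 = bar (2*m) t j"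
  "word m (s, t, i, j) 3 = bar (2*m) (s \<noteq> t) (wrap (2*m) (int i + int j - 1))"
  "word m (s, t, i, j) 4 = bar (2*m) ((s \<noteq> t) \<noteq> even i)
     (wrap (2*m) ((int i - 1) div 2 + int j + (if s then int m else 0)))"
  by (simp_all add: word_def)

section \<open>Recovering the parameters from two letters\<close>

lemma UNIV_4_eq: "(UNIV :: 4 set) = {1, 2, 3, 4}"
  using UNIV_4 by auto

lemma cong_imp_eq_int:
  assumes "[a = b] (mod n)" "\<bar>a - b\<bar> < (n::int)"
  shows "a = b"
  using assms dvd_imp_le_int[of "a - b" n] by (force simp: cong_iff_dvd_diff)

lemma half_index_bounds: "i \<in> {1..2*m} \<Longrightarrow> (int i - 1) div 2 \<in> {0..<int m}"
  by auto

text \<open>Adding or subtracting \<open>m\<close> is the same modulo \<open>2 * m\<close>, so \<open>s\<close> and half the index of \<open>x\<close>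
  can be read off from either combination.\<close>

lemma half_cong_add:
  assumes "p \<in> {0..<int m}" "p' \<in> {0..<int m}"
    and "[p + (if s then int m else 0) = p' + (if s' then int m else 0)] (mod int (2*m))"
  shows "s = s' \<and> p = p'"
proof -
  \<comment> \<open>Both sides lie in \<open>{0..<2*m}\<close>, with \<open>s\<close> and
    \<open>p\<close> as the two digits in base \<open>m\<close>, so congruence forces
    equality.\<close>
  have "p + (if s then int m else 0) = p' + (if s' then int m else 0)"
    by (rule cong_imp_eq_int[OF assms(3)]) (use assms(1,2) in auto)
  then show ?thesis using assms(1,2) by (auto split: if_splits)
qed

lemma half_cong_diff:
  assumes "p \<in> {0..<int m}" "p' \<in> {0..<int m}"
    and "[p - (if s then int m else 0) = p' - (if s' then int m else 0)] (mod int (2*m))"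
  shows "s = s' \<and> p = p'"
proof -
  \<comment> \<open>Here both sides lie in \<open>{-m..<m}\<close>, again an interval of length
    \<open>2*m\<close>.\<close>
  have "p - (if s then int m else 0) = p' - (if s' then int m else 0)"
    by (rule cong_imp_eq_int[OF assms(3)]) (use assms(1,2) in auto)
  then show ?thesis using assms(1,2) by (auto split: if_splits)
qed

lemma index_eqI:
  assumes "(int i - 1) div 2 = (int i' - 1) div 2" "even i = even i'"
  shows "i = i'"
  using assms by presburger

lemma index_cong_imp_eq:
  assumes "i \<in> {1..n}" "j \<in> {1..n}" "[int i = int j] (mod int n)"
  shows "i = j"
  using cong_imp_eq_int[OF assms(3)] assms(1,2) by auto

text \<open>Six cases, one per pair of colours. Each letter yields one equation of flags and one of
  indices. When \<open>x\<close> or \<open>y\<close> is paired with \<open>z\<close>, or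
  \<open>x\<close> with \<open>w\<close>, the missing index comes from cancelling in a congruence.
  The pairs \<open>y\<close>, \<open>w\<close> and \<open>z\<close>, \<open>w\<close> must recover
  \<open>s\<close> too, and do so through the shift by \<open>m\<close> in the index of
  \<open>w\<close>.\<close>

lemma word_pair_inj:
  assumes m: "m > 0" and v: "v \<in> params m" "v' \<in> params m"
    and cd: "c \<noteq> d" and eq: "word m v c = word m v' c" "word m v d = word m v' d"
  shows "v = v'"
proof -
  obtain s t i j where v_eq: "v = (s, t, i, j)" by (cases v)
  obtain s' t' i' j' where v'_eq: "v' = (s', t', i', j')" by (cases v')
  have i: "i \<in> {1..2*m}" "i' \<in> {1..2*m}" and j: "j \<in> {1..2*m}" "j' \<in> {1..2*m}"
    using v by (auto simp: v_eq v'_eq params_def)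
  define p where "p = (int i - 1) div 2"
  define p' where "p' = (int i' - 1) div 2"
  note half = half_index_bounds[OF i(1), folded p_def] half_index_bounds[OF i(2), folded p'_def]
  let ?m = "\<lambda>s. if s then int m else 0"
  have n: "2 * m > 0" using m by simp
  have x: "word m v 1 = word m v' 1 \<longleftrightarrow> s = s' \<and> i = i'"
    and y: "word m v 2 = word m v' 2 \<longleftrightarrow> t = t' \<and> j = j'"
    and z: "word m v 3 = word m v' 3 \<longleftrightarrow> (s \<noteq> t) = (s' \<noteq> t')
      \<and> [int i + int j - 1 = int i' + int j' - 1] (mod int (2*m))"
    and w: "word m v 4 = word m v' 4 \<longleftrightarrow> ((s \<noteq> t) \<noteq> even i) = ((s' \<noteq> t') \<noteq> even i')
      \<and> [p + int j + ?m s = p' + int j' + ?m s'] (mod int (2*m))"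
    unfolding v_eq v'_eq word_nth p_def p'_def
    by (rule bar_eq_iff[OF i] bar_eq_iff[OF j] bar_wrap_eq_iff[OF n])+
  have xy: "v = v'" if "word m v 1 = word m v' 1" "word m v 2 = word m v' 2"
    using that unfolding x y by (simp add: v_eq v'_eq)
  have xz: "v = v'" if "word m v 1 = word m v' 1" "word m v 3 = word m v' 3"
  proof -
    have "[int j = int j'] (mod int (2*m))"
      using that unfolding x z by (auto simp: cong_iff_dvd_diff)
    then show ?thesis using that index_cong_imp_eq[OF j] unfolding x z by (auto simp: v_eq v'_eq)
  qed
  have yz: "v = v'" if "word m v 2 = word m v' 2" "word m v 3 = word m v' 3"
  proof -
    have "[int i = int i'] (mod int (2*m))"
      using that unfolding y z by (auto simp: cong_iff_dvd_diff)
    then show ?thesis using that index_cong_imp_eq[OF i] unfolding y z by (auto simp: v_eq v'_eq)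
  qed
  have xw: "v = v'" if "word m v 1 = word m v' 1" "word m v 4 = word m v' 4"
  proof -
    have "[int j = int j'] (mod int (2*m))"
      using that unfolding x w p_def p'_def by (auto simp: cong_iff_dvd_diff)
    then show ?thesis using that index_cong_imp_eq[OF j] unfolding x w by (auto simp: v_eq v'_eq)
  qed
  have yw: "v = v'" if "word m v 2 = word m v' 2" "word m v 4 = word m v' 4"
  proof -
    \<comment> \<open>With \<open>j\<close> known, the index of \<open>w\<close> leaves the two base
      \<open>m\<close> digits. Once \<open>s\<close> and \<open>t\<close> are known, the flag of
      \<open>w\<close> gives the parity of \<open>i\<close>, which together with \<open>p\<close>
      determines \<open>i\<close>.\<close>
    have "[p + ?m s = p' + ?m s'] (mod int (2*m))"
      using that unfolding y w by (auto simp: cong_iff_dvd_diff algebra_simps)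
    then have "s = s' \<and> p = p'" by (rule half_cong_add[OF half])
    then show ?thesis using that index_eqI[of i i'] unfolding y w p_def p'_def
      by (auto simp: v_eq v'_eq)
  qed
  have zw: "v = v'" if "word m v 3 = word m v' 3" "word m v 4 = word m v' 4"
  proof -
    \<comment> \<open>The flags of \<open>z\<close> and \<open>w\<close> differ exactly when
      \<open>i\<close> is even.\<close>
    have even: "even i = even i'" using that unfolding z w by blast
    \<comment> \<open>This quantity is 1 for odd and 2 for even \<open>i\<close>. Subtracting the
      index of \<open>w\<close> from that of \<open>z\<close> cancels \<open>j\<close> and leaves
      \<open>i - 1 - p - ?m s\<close>, that is, \<open>p - ?m s\<close> up to a constant depending
      only on the parity.\<close>
    then have "int i - 2 * p = int i' - 2 * p'"
      using i unfolding p_def p'_def by presburger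
    moreover have "int (2*m) dvd (int i + int j - 1 - (int i' + int j' - 1))
        - (p + int j + ?m s - (p' + int j' + ?m s'))"
      using that unfolding z w cong_iff_dvd_diff by (blast intro: dvd_diff)
    moreover have "(int i + int j - 1 - (int i' + int j' - 1))
        - (p + int j + ?m s - (p' + int j' + ?m s'))
        = p - ?m s - (p' - ?m s')"
      using calculation(1) by linarith
    ultimately have "[p - ?m s = p' - ?m s'] (mod int (2*m))"
      unfolding cong_iff_dvd_diff by (simp only:)
    then have "s = s' \<and> p = p'" by (rule half_cong_diff[OF half])
    then have "s = s' \<and> i = i'" using index_eqI[OF _ even] unfolding p_def p'_def by blast
    \<comment> \<open>Knowing \<open>s\<close> and \<open>i\<close> is knowing the letter
      \<open>x\<close>, so the case of \<open>x\<close> and \<open>z\<close> applies.\<close>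
    then show ?thesis using that xz x by blast
  qed
  have "c \<in> {1, 2, 3, 4}" "d \<in> {1, 2, 3, 4}" using UNIV_4_eq by blast+
  then show ?thesis
    using cd eq xy xz yz xw yw zw by (elim insertE emptyE; hypsubst; blast)
qed

lemma inj_on_word: "m > 0 \<Longrightarrow> inj_on (word m) (params m)"
  by (rule inj_onI) (rule word_pair_inj[of m _ _ 1 2], simp_all)

lemma word_in_range:
  assumes "m > 0" "v \<in> params m"
  shows "word m v c \<in> {1..4*m}"
proof -
  have n: "2 * m > 0" using assms by simp
  obtain s t i j where v: "v = (s, t, i, j)" by (cases v)
  have "i \<in> {1..2*m}" "j \<in> {1..2*m}" using assms(2) by (auto simp: v params_def)
  moreover have "bar (2*m) b l \<in> {1..4*m}" if "l \<in> {1..2*m}" for b l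
    using that by (auto simp: bar_def)
  ultimately show ?thesis
    using wrap_bounds[OF n] by (simp add: v word_def del: atLeastAtMost_iff One_nat_def)
qed

lemma orthogonal_array_word:
  assumes m: "m > 0"
  shows "orthogonal_array (4*m) (word m ` params m)"
proof
  show "0 < 4 * m" using m by simp
  show "\<phi> c \<in> {1..4*m}" if "\<phi> \<in> word m ` params m" for \<phi> c
    using that word_in_range[OF m] by blast
  show "card (word m ` params m) = (4*m)\<^sup>2"
    unfolding card_image[OF inj_on_word[OF m]]
    by (simp add: params_def card_cartesian_product power2_eq_square)
  show "inj_on (\<lambda>\<phi>. (\<phi> c, \<phi> d)) (word m ` params m)" if "c \<noteq> d" for c d
  proof (rule inj_onI)
    fix \<phi> \<psi>
    assume *: "\<phi> \<in> word m ` params m" "\<psi> \<in> word m ` params m" "(\<phi> c, \<phi> d) = (\<psi> c, \<psi> d)"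
    then obtain v v' where "\<phi> = word m v" "\<psi> = word m v'" "v \<in> params m" "v' \<in> params m"
      by blast
    then show "\<phi> = \<psi>" using word_pair_inj[OF m _ _ that] * by blast
  qed
qed

section \<open>Comparison with the displayed polynomial\<close>

lemma mvar_mult_eq_word_monom:
  "X (\<phi> 1) * Y (\<phi> 2) * Z (\<phi> 3) * W (\<phi> 4)
    = Poly_Mapping.single (word_monom UNIV \<phi>) (1::'a::field)"
  by (simp add: X_def Y_def Z_def W_def mvar_def mult_single word_monom_def sum_4)

lemma word_array_poly_eq:
  assumes m: "m > 0"
  shows "orthogonal_array.poly (word m ` params m) = (\<Sum>s\<in>UNIV. \<Sum>t\<in>UNIV. \<Sum>i = 1..2*m. \<Sum>j = 1..2*m.
    X (bar (2*m) s i) * Y (bar (2*m) t j)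
    * Z (bar (2*m) (s \<noteq> t) (wrap (2*m) (int i + int j - 1)))
    * W (bar (2*m) ((s \<noteq> t) \<noteq> even i)
        (wrap (2*m) ((int i - 1) div 2 + int j + (if s then int m else 0)))) :: 'a::field mpoly)"
proof -
  interpret orthogonal_array "4*m" "word m ` params m" by (rule orthogonal_array_word[OF m])
  have "poly = (\<Sum>v\<in>params m. Poly_Mapping.single (word_monom UNIV (word m v)) (1::'a))"
    by (simp add: poly_def sum.reindex[OF inj_on_word[OF m]])
  then show ?thesis
    by (simp add: params_def sum.cartesian_product' word_nth flip: mvar_mult_eq_word_monom)
qed

theorem theorem3p3:
  fixes f :: "'a::field mpoly" and k m :: nat
  assumes "m > 0" and "k = 4 * m"
    and "f =
        (\<Sum>i | i \<in> {1..2*m} \<and> odd i. \<Sum>j = 1..2*m.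
          X i * Y j * Z (wrap (2*m) (int i + int j - 1))
            * W (wrap (2*m) ((int i - 1) div 2 + int j)))
      + (\<Sum>i | i \<in> {1..2*m} \<and> odd i. \<Sum>j = 1..2*m.
          Xb k i * Y j * Zb k (wrap (2*m) (int i + int j - 1))
            * Wb k (wrap (2*m) ((int i - 1) div 2 + int j + int m)))
      + (\<Sum>i | i \<in> {1..2*m} \<and> odd i. \<Sum>j = 1..2*m.
          X i * Yb k j * Zb k (wrap (2*m) (int i + int j - 1))
            * Wb k (wrap (2*m) ((int i - 1) div 2 + int j)))
      + (\<Sum>i | i \<in> {1..2*m} \<and> odd i. \<Sum>j = 1..2*m.
          Xb k i * Yb k j * Z (wrap (2*m) (int i + int j - 1))
            * W (wrap (2*m) ((int i - 1) div 2 + int j + int m)))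
      + (\<Sum>i | i \<in> {1..2*m} \<and> even i. \<Sum>j = 1..2*m.
          X i * Y j * Z (wrap (2*m) (int i + int j - 1))
            * Wb k (wrap (2*m) ((int i - 2) div 2 + int j)))
      + (\<Sum>i | i \<in> {1..2*m} \<and> even i. \<Sum>j = 1..2*m.
          Xb k i * Y j * Zb k (wrap (2*m) (int i + int j - 1))
            * W (wrap (2*m) ((int i - 2) div 2 + int j + int m)))
      + (\<Sum>i | i \<in> {1..2*m} \<and> even i. \<Sum>j = 1..2*m.
          X i * Yb k j * Zb k (wrap (2*m) (int i + int j - 1))
            * W (wrap (2*m) ((int i - 2) div 2 + int j)))
      + (\<Sum>i | i \<in> {1..2*m} \<and> even i. \<Sum>j = 1..2*m.
          Xb k i * Yb k j * Z (wrap (2*m) (int i + int j - 1))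
            * Wb k (wrap (2*m) ((int i - 2) div 2 + int j + int m)))"
  shows "balanced_neighborly k f"
proof -
  have n: "k div 2 = 2 * m" using assms(2) by simp
  interpret orthogonal_array "4*m" "word m ` params m" by (rule orthogonal_array_word[OF assms(1)])
  \<comment> \<open>Separating odd from even \<open>i\<close> turns the four sums given by the flags
    into the eight displayed ones.\<close>
  have split: "(\<Sum>i = 1..2*m. \<Sum>j = 1..2*m. h i j)
      = (\<Sum>i | i \<in> {1..2*m} \<and> odd i. \<Sum>j = 1..2*m. h i j)
      + (\<Sum>i | i \<in> {1..2*m} \<and> even i. \<Sum>j = 1..2*m. h i j)" for h :: "nat \<Rightarrow> nat \<Rightarrow> 'a mpoly"
    by (subst sum.union_disjoint[symmetric]) (auto intro!: sum.cong)
  \<comment> \<open>For even \<open>i\<close> the displayed sums use \<open>(i - 2) div 2\<close>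
    and the words use \<open>(i - 1) div 2\<close>; both equal \<open>i div 2 - 1\<close>.\<close>
  have half: "(int i - 1) div 2 = int i div 2 - 1" if "even i" for i
    using that by presburger
  have "f = poly"
    unfolding assms(3) word_array_poly_eq[OF assms(1)] UNIV_bool split Xb_def Yb_def Zb_def Wb_def n
    by (simp add: bar_def half ac_simps)
  then show ?thesis
    using balanced_neighborly_poly assms(2) by simp
qed

end
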